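(* Let $G=(\mathcal{N},(r_S)_{\emptyset\subseteq S\subseteq\mathcal{N}})$ be a quitting game with $\mathcal{N}=\{1,\dots,N\}$, let $r_{max}:=\max\{|r_S^n| : n\in\mathcal{N},\ S\subseteq\mathcal{N}\}$, and let $\varepsilon\in(0,1)$. Define $$V:=\big\{\tilde v\in[-2r_{max},2r_{max}]^N \ \big|\ \exists n\in\mathcal{N}:\ \tilde v^n\le1\big\}.$$ Assume that 1. $r_{\{n\}}^n=1$ for every $n\in\mathcal{N}$; 2. for every $v\in V$ there exists an equilibrium $p$ in the one-step game $\Gamma_v$ such that either (a) $p=(0,0,\dots,0)^T$, or (b) $p\ne(0,0,\dots,0)^T$ and $\gamma_v^n(p)\le1$ for some $n\in\mathcal{N}$ with $p^n>0$. Then $\psi_\varepsilon(v)\ne\emptyset$ for all $v\in V$, where $$\psi_\varepsilon(v):=\big\{\gamma_v(p)\ \big|\ p\in[0,1]^N,\ \gamma_v(p)\in V,\ p\text{ is }2\varepsilon r_{max}\text{-perfect in }\Gamma_v,\ \varrho(p,\emptyset)\le1-\varepsilon\big\}.$$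
   Context: A quitting game is a tuple $G=(\mathcal{N},(r_S)_{\emptyset\subseteq S\subseteq\mathcal{N}})$, where $\mathcal{N}=\{1,\dots,N\}$ is a finite set of players and $r_S=(r_S^1,\dots,r_S^N)^T\in\mathbb{R}^N$ is the payoff vector when exactly the players in $S$ quit, with $r_\emptyset=(0,\dots,0)^T$. For $v=(v^1,\dots,v^N)^T\in\mathbb{R}^N$, the one-step game $\Gamma_v=(G,v)$ is the one-stage game in which each player chooses continue (action $0$) or quit (action $1$); the payoff vector is $v$ if nobody quits and $r_S$ if $S\ne\emptyset$ is the set of quitting players. A strategy profile in $\Gamma_v$ is a vector $p=(p^1,\dots,p^N)^T\in[0,1]^N$, where $p^n$ is the probability that player $n$ quits (players act independently). For $S\subseteq\mathcal{N}$ put $\varrho(p,S):=\prod_{n\in S}p^n\prod_{m\in\mathcal{N}\setminus S}(1-p^m)$. The expected payoff is $\gamma_v(p)=(\gamma_v^1(p),\dots,\gamma_v^N(p))^T:=\varrho(p,\emptyset)\,v+\sum_{S\subseteq\mathcal{N}}\varrho(p,S)\,r_S$. For $b\in[0,1]$, $(p^{-n},b)$ denotes the profile obtained from $p$ by replacing the $n$-th component by $b$. $p$ is an equilibrium (Nash-equilibrium) in $\Gamma_v$ if for all $n\in\mathcal{N}$ and all $\tilde p^n\in[0,1]$: $\gamma_v^n(p)\ge\gamma_v^n((p^{-n},\tilde p^n))$. For $\eta\ge0$, an action $b\in\{0,1\}$ of player $n$ is an $\eta$-best reply for $p^{-n}$ if $\gamma_v^n((p^{-n},b))\ge\max_{\tilde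 b\in\{0,1\}}\gamma_v^n((p^{-n},\tilde b))-\eta$. Let $supp(x)=\{0\}$ if $x=0$, $\{0,1\}$ if $x\in(0,1)$, $\{1\}$ if $x=1$. $p$ is $\eta$-perfect in $\Gamma_v$ if for every $n\in\mathcal{N}$ every action $b\in supp(p^n)$ is an $\eta$-best reply for $p^{-n}$. *)

theory Defs
  imports "HOL-Analysis.Analysis"
begin

text \<open>
  The players are the elements of a finite type \<open>'n\<close> (so \<open>N = CARD('n)\<close>); \<open>r S $ n\<close> is the
  payoff of player \<open>n\<close> when exactly the players in \<open>S\<close> quit.
\<close>

definition quitting_game :: "('n::finite set \<Rightarrow> real ^ 'n) \<Rightarrow> bool" where
  "quitting_game r \<longleftrightarrow> r {} = 0"

definition profiles :: "(real ^ 'n::finite) set" where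
  "profiles = {p. \<forall>n. p $ n \<in> {0..1}}"

text \<open>The probability that exactly the players in \<open>S\<close> quit under \<open>p\<close>.\<close>

definition quit_prob :: "real ^ 'n::finite \<Rightarrow> 'n set \<Rightarrow> real" where
  "quit_prob p S = (\<Prod>n\<in>S. p $ n) * (\<Prod>m\<in>UNIV - S. 1 - p $ m)"

text \<open>
  The sum includes \<open>S = {}\<close>, whose term vanishes for a quitting game since \<open>r {} = 0\<close>.
\<close>

definition payoff ::
  "('n::finite set \<Rightarrow> real ^ 'n) \<Rightarrow> real ^ 'n \<Rightarrow> real ^ 'n \<Rightarrow> real ^ 'n" where
  "payoff r v p = quit_prob p {} *\<^sub>R v + (\<Sum>S\<in>UNIV. quit_prob p S *\<^sub>R r S)"

text \<open>The profile \<open>(p\<^sup>-\<^sup>n, b)\<close>; the pure actions continue and quit are the reals \<open>0\<close> and \<open>1\<close>.\<close>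

definition deviate :: "real ^ 'n::finite \<Rightarrow> 'n \<Rightarrow> real \<Rightarrow> real ^ 'n" where
  "deviate p n b = (\<chi> m. if m = n then b else p $ m)"

definition equilibrium ::
  "('n::finite set \<Rightarrow> real ^ 'n) \<Rightarrow> real ^ 'n \<Rightarrow> real ^ 'n \<Rightarrow> bool" where
  "equilibrium r v p \<longleftrightarrow> p \<in> profiles \<and>
     (\<forall>n. \<forall>q\<in>{0..1}. payoff r v p $ n \<ge> payoff r v (deviate p n q) $ n)"

definition best_reply ::
  "('n::finite set \<Rightarrow> real ^ 'n) \<Rightarrow> real ^ 'n \<Rightarrow> real \<Rightarrow> real ^ 'n \<Rightarrow> 'n \<Rightarrow> real \<Rightarrow> bool" where
  "best_reply r v \<eta> p n b \<longleftrightarrow>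
     payoff r v (deviate p n b) $ n \<ge> (MAX b'\<in>{0, 1}. payoff r v (deviate p n b') $ n) - \<eta>"

definition action_supp :: "real \<Rightarrow> real set" where
  "action_supp x = (if x = 0 then {0} else if x = 1 then {1} else {0, 1})"

definition perfect ::
  "('n::finite set \<Rightarrow> real ^ 'n) \<Rightarrow> real ^ 'n \<Rightarrow> real \<Rightarrow> real ^ 'n \<Rightarrow> bool" where
  "perfect r v \<eta> p \<longleftrightarrow> (\<forall>n. \<forall>b\<in>action_supp (p $ n). best_reply r v \<eta> p n b)"

definition r_max :: "('n::finite set \<Rightarrow> real ^ 'n) \<Rightarrow> real" where
  "r_max r = Max {\<bar>r S $ n\<bar> | n S. True}"

definition V :: "('n::finite set \<Rightarrow> real ^ 'n) \<Rightarrow> (real ^ 'n) set" where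
  "V r = {v. (\<forall>n. v $ n \<in> {- 2 * r_max r .. 2 * r_max r}) \<and> (\<exists>n. v $ n \<le> 1)}"

definition \<psi> ::
  "('n::finite set \<Rightarrow> real ^ 'n) \<Rightarrow> real \<Rightarrow> real ^ 'n \<Rightarrow> (real ^ 'n) set" where
  "\<psi> r \<epsilon> v = {payoff r v p | p. p \<in> profiles \<and> payoff r v p \<in> V r \<and>
      perfect r v (2 * \<epsilon> * r_max r) p \<and> quit_prob p {} \<le> 1 - \<epsilon>}"

end

theory Submission
  imports Defs
begin

text \<open>
  In each case of the equilibrium hypothesis, either quitting already has probability at least
  \<open>\<epsilon>\<close>, or some player \<open>n\<close> is indifferent between continuing and quitting and receives at most
  \<open>1\<close>. In the latter situation raise the quitting probability of \<open>n\<close> until the continuation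
  probability drops to \<open>1 - \<epsilon>\<close>. The payoff of \<open>n\<close> does not change, so the new payoff stays in \<open>V\<close>.
  All payoffs are affine in the action of \<open>n\<close>, and the new profile is a mixture of the equilibrium,
  with weight \<open>1 - t\<close>, and of the profile where \<open>n\<close> quits, with weight \<open>t \<le> \<epsilon>\<close>; in the latter
  the payoffs lie in \<open>[- r_max, r_max]\<close>, so best replies lose at most \<open>2 \<epsilon> r_max\<close>.
\<close>

section \<open>Deviations, quitting probabilities and payoffs\<close>

lemma deviate_nth [simp]: "deviate p n b $ m = (if m = n then b else p $ m)"
  by (simp add: deviate_def)

lemma deviate_same [simp]: "deviate p n (p $ n) = p"
  by (simp add: vec_eq_iff)

lemma deviate_deviate_same [simp]: "deviate (deviate p n a) n b = deviate p n b"
  by (simp add: vec_eq_iff)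

lemma deviate_commute: "m \<noteq> n \<Longrightarrow> deviate (deviate p n a) m b = deviate (deviate p m b) n a"
  by (simp add: vec_eq_iff)

lemma deviate_in_profiles: "p \<in> profiles \<Longrightarrow> b \<in> {0..1} \<Longrightarrow> deviate p n b \<in> profiles"
  by (simp add: profiles_def)

lemma abs_r_le_r_max: "\<bar>r S $ n\<bar> \<le> r_max r"
proof -
  have "{\<bar>r S $ n\<bar> | n S. True} = (\<lambda>(n, S). \<bar>r S $ n\<bar>) ` UNIV"
    by auto
  then have "finite {\<bar>r S $ n\<bar> | n S. True}"
    by (metis finite finite_imageI)
  then show ?thesis
    unfolding r_max_def by (rule Max_ge) blast
qed

lemma r_max_nonneg: "0 \<le> r_max r"
  using abs_r_le_r_max[of r "{}"] by (meson abs_ge_zero order_trans)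

lemma quit_prob_nonneg: "p \<in> profiles \<Longrightarrow> 0 \<le> quit_prob p S"
  by (auto simp: quit_prob_def profiles_def intro!: mult_nonneg_nonneg prod_nonneg)

text \<open>Expand the product over all players of \<open>p $ n + (1 - p $ n) = 1\<close>.\<close>

lemma sum_quit_prob: "(\<Sum>S\<in>UNIV. quit_prob p S) = 1"
  using prod_add[of UNIV "\<lambda>n. p $ n" "\<lambda>n. 1 - p $ n"] by (simp add: quit_prob_def)

text \<open>Splits off the factor of player \<open>n\<close>, the only one in which \<open>b\<close>
  occurs; hence the dependence on \<open>b\<close> is affine.\<close>

lemma quit_prob_deviate:
  "quit_prob (deviate p n b) S =
     (if n \<in> S then b else 1 - b) * ((\<Prod>k\<in>S - {n}. p $ k) * (\<Prod>k\<in>UNIV - S - {n}. 1 - p $ k))"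
proof (cases "n \<in> S")
  case True
  then have "UNIV - S - {n} = UNIV - S" by auto
  moreover have "(\<Prod>k\<in>UNIV - S. 1 - deviate p n b $ k) = (\<Prod>k\<in>UNIV - S. 1 - p $ k)"
    using True by (intro prod.cong) auto
  ultimately show ?thesis
    using True by (simp add: quit_prob_def prod.remove[of S n])
next
  case False
  then have "S - {n} = S" "n \<in> UNIV - S" by auto
  moreover have "(\<Prod>k\<in>S. deviate p n b $ k) = (\<Prod>k\<in>S. p $ k)"
    using False by (intro prod.cong) auto
  ultimately show ?thesis
    using False by (simp add: quit_prob_def prod.remove[of "UNIV - S" n])
qed

text \<open>The new action is the mixture \<open>(1 - t) * p $ n + t * 1\<close>, written so that
  the probability with which \<open>n\<close> continues is visibly scaled by
  \<open>1 - t\<close>.\<close>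

lemma quit_prob_deviate_affine:
  "quit_prob (deviate p n (1 - (1 - p $ n) * (1 - t))) S =
     (1 - t) * quit_prob p S + t * quit_prob (deviate p n 1) S"
proof -
  have "quit_prob p S = quit_prob (deviate p n (p $ n)) S" by simp
  then show ?thesis
    unfolding quit_prob_deviate by (simp add: algebra_simps)
qed

lemma quit_prob_deviate_quit_empty [simp]: "quit_prob (deviate p n 1) {} = 0"
  by (simp add: quit_prob_deviate)

lemma payoff_deviate_affine:
  "payoff r v (deviate p n (1 - (1 - p $ n) * (1 - t))) =
     (1 - t) *\<^sub>R payoff r v p + t *\<^sub>R payoff r v (deviate p n 1)"
  unfolding payoff_def quit_prob_deviate_affine
  by (simp add: scaleR_add_left scaleR_add_right scaleR_sum_right sum.distrib)

lemma payoff_eq_pure: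
  "payoff r v p $ n = (1 - p $ n) * payoff r v (deviate p n 0) $ n
     + p $ n * payoff r v (deviate p n 1) $ n"
  \<comment> \<open>Starting from action \<open>0\<close>, the shift with parameter \<open>t\<close>
    leads to action \<open>t\<close>; here \<open>t = p $ n\<close>.\<close>
  using payoff_deviate_affine[of r v "deviate p n 0" n "p $ n"] by simp

text \<open>A payoff is a convex combination of \<open>v $ n\<close> and the values
  \<open>r S $ n\<close>. The bound on \<open>v\<close> is conditional so that \<open>v\<close> is
  irrelevant as soon as some player quits surely.\<close>

lemma abs_payoff_le:
  assumes "r {} = 0" "p \<in> profiles" "\<And>S. \<bar>r S $ n\<bar> \<le> c" "quit_prob p {} \<noteq> 0 \<Longrightarrow> \<bar>v $ n\<bar> \<le> c"
  shows "\<bar>payoff r v p $ n\<bar> \<le> c"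
proof -
  have "payoff r v p $ n = quit_prob p {} * v $ n + (\<Sum>S\<in>UNIV - {{}}. quit_prob p S * r S $ n)"
    using assms(1) by (simp add: payoff_def sum.remove[of UNIV "{}"])
  also have "\<bar>\<dots>\<bar> \<le> \<bar>quit_prob p {} * v $ n\<bar> + (\<Sum>S\<in>UNIV - {{}}. \<bar>quit_prob p S * r S $ n\<bar>)"
    by (rule order_trans[OF abs_triangle_ineq add_left_mono[OF sum_abs]])
  also have "\<dots> \<le> quit_prob p {} * c + (\<Sum>S\<in>UNIV - {{}}. quit_prob p S * c)"
  proof (intro add_mono sum_mono)
    show "\<bar>quit_prob p {} * v $ n\<bar> \<le> quit_prob p {} * c"
      using assms(4) quit_prob_nonneg[OF assms(2), of "{}"]
      by (cases "quit_prob p {} = 0") (auto simp: abs_mult intro: mult_left_mono)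
    show "\<bar>quit_prob p S * r S $ n\<bar> \<le> quit_prob p S * c" for S
      using assms(3)[of S] quit_prob_nonneg[OF assms(2), of S]
      by (auto simp: abs_mult intro: mult_left_mono)
  qed
  also have "\<dots> = (\<Sum>S\<in>UNIV. quit_prob p S * c)"
    by (simp add: sum.remove[of UNIV "{}"])
  also have "\<dots> = c"
    by (simp add: sum_distrib_right[symmetric] sum_quit_prob)
  finally show ?thesis .
qed

section \<open>Best replies and equilibria\<close>

lemma best_reply_iff:
  "best_reply r v \<eta> p n b \<longleftrightarrow>
     (\<forall>b'\<in>{0, 1}. payoff r v (deviate p n b') $ n - \<eta> \<le> payoff r v (deviate p n b) $ n)"
  by (auto simp: best_reply_def)

lemma perfect_mono: "perfect r v \<eta> p \<Longrightarrow> \<eta> \<le> \<eta>' \<Longrightarrow> perfect r v \<eta>' p"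
  unfolding perfect_def best_reply_iff by fastforce

text \<open>The equilibrium payoff is an average, with two positive weights, of the pure payoffs.
  Neither exceeds it, so both equal it.\<close>

lemma equilibrium_pure_payoffs_eq:
  assumes "equilibrium r v p" "0 < p $ n" "p $ n < 1" "b \<in> {0, 1}"
  shows "payoff r v (deviate p n b) $ n = payoff r v p $ n"
proof -
  let ?A = "payoff r v (deviate p n 0) $ n" and ?B = "payoff r v (deviate p n 1) $ n"
    and ?C = "payoff r v p $ n"
  have le: "?A \<le> ?C" "?B \<le> ?C"
    using assms(1) by (auto simp: equilibrium_def)
  have "(1 - p $ n) * (?C - ?A) + p $ n * (?C - ?B) = 0"
    using payoff_eq_pure[of r v p n] by (simp add: algebra_simps)
  moreover have "0 \<le> (1 - p $ n) * (?C - ?A)" "0 \<le> p $ n * (?C - ?B)"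
    using le assms by auto
  ultimately have "(1 - p $ n) * (?C - ?A) = 0" "p $ n * (?C - ?B) = 0"
    by linarith+
  then show ?thesis
    using assms by auto
qed

lemma equilibrium_imp_perfect:
  assumes "equilibrium r v p"
  shows "perfect r v 0 p"
  unfolding perfect_def best_reply_iff
proof (intro allI ballI)
  fix n and b b' :: real
  assume b: "b \<in> action_supp (p $ n)" and b': "b' \<in> {0, 1}"
  have pn: "0 \<le> p $ n" "p $ n \<le> 1"
    using assms by (auto simp: equilibrium_def profiles_def)
  have "payoff r v (deviate p n b) $ n = payoff r v p $ n"
  proof (cases "b = p $ n")
    case False
    then have "0 < p $ n" "p $ n < 1" "b \<in> {0, 1}"
      using b pn by (auto simp: action_supp_def split: if_splits)
    then show ?thesis
      using equilibrium_pure_payoffs_eq[OF assms] by blast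
  qed simp
  moreover have "payoff r v (deviate p n b') $ n \<le> payoff r v p $ n"
    using assms b' by (auto simp: equilibrium_def)
  ultimately show "payoff r v (deviate p n b') $ n - 0 \<le> payoff r v (deviate p n b) $ n"
    by simp
qed

section \<open>Raising the quitting probability of an indifferent player\<close>

lemma perfect_shift_to_quit:
  assumes r0: "r {} = 0" and p: "p \<in> profiles" and perf: "perfect r v 0 p"
    and t: "0 \<le> t" "t \<le> 1"
    and indiff: "payoff r v (deviate p n 0) $ n = payoff r v (deviate p n 1) $ n"
  shows "perfect r v (2 * t * r_max r) (deviate p n (1 - (1 - p $ n) * (1 - t)))"
  unfolding perfect_def best_reply_iff
proof (intro allI ballI)
  let ?q = "deviate p n (1 - (1 - p $ n) * (1 - t))"
  fix m and b b' :: real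
  assume b: "b \<in> action_supp (?q $ m)" and b': "b' \<in> {0, 1}"
  from b have b01: "b \<in> {0, 1}"
    by (auto simp: action_supp_def split: if_splits)
  show "payoff r v (deviate ?q m b') $ m - 2 * t * r_max r \<le> payoff r v (deviate ?q m b) $ m"
  \<comment> \<open>A deviation of \<open>n\<close> overwrites the shift, so \<open>n\<close> faces
    the same pure payoffs as under \<open>p\<close>. For any other player the support is
    unchanged.\<close>
  proof (cases "m = n")
    case True
    have "0 \<le> t * r_max r"
      using t r_max_nonneg[of r] by simp
    then show ?thesis
      using True b01 b' indiff by auto
  next
    case False
    let ?P = "\<lambda>c. payoff r v (deviate p m c) $ m"
      and ?Q = "\<lambda>c. payoff r v (deviate (deviate p m c) n 1) $ m"
    have aff: "payoff r v (deviate ?q m c) $ m = (1 - t) * ?P c + t * ?Q c" for c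
      using payoff_deviate_affine[of r v "deviate p m c" n t] False
      by (simp add: deviate_commute)
    have "b \<in> action_supp (p $ m)"
      using b False by simp
    then have "?P b' \<le> ?P b"
      using perf b' unfolding perfect_def best_reply_iff by fastforce
    then have 1: "(1 - t) * ?P b' \<le> (1 - t) * ?P b"
      using t by (intro mult_left_mono) auto
    \<comment> \<open>Player \<open>n\<close> quits surely here, so \<open>v\<close> does not enter
      and the bound is \<open>r_max r\<close>, although \<open>v\<close> itself is not assumed
      bounded.\<close>
    have Q: "\<bar>?Q c\<bar> \<le> r_max r" if "c \<in> {0, 1}" for c
      using that p r0
      by (intro abs_payoff_le deviate_in_profiles abs_r_le_r_max) auto
    have "?Q b' - ?Q b \<le> 2 * r_max r"
      using Q[OF b'] Q[OF b01] by linarith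
    then have "t * (?Q b' - ?Q b) \<le> t * (2 * r_max r)"
      using t by (intro mult_left_mono) auto
    then show ?thesis
      using 1 unfolding aff by (simp add: algebra_simps)
  qed
qed

text \<open>The box is preserved because payoffs average \<open>v\<close> and the
  \<open>r S\<close>; player \<open>n\<close> witnesses the remaining condition.\<close>

lemma payoff_in_V:
  assumes "r {} = 0" "p \<in> profiles" "v \<in> V r" "payoff r v p $ n \<le> 1"
  shows "payoff r v p \<in> V r"
proof -
  have "\<bar>payoff r v p $ m\<bar> \<le> 2 * r_max r" for m
  proof (rule abs_payoff_le)
    show "r {} = 0" "p \<in> profiles"
      by (fact assms(1,2))+
    show "\<bar>r S $ m\<bar> \<le> 2 * r_max r" for S
      using abs_r_le_r_max[of r S m] r_max_nonneg[of r] by linarith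
    show "\<bar>v $ m\<bar> \<le> 2 * r_max r"
      using assms(3) by (auto simp: V_def abs_le_iff minus_le_iff)
  qed
  then show ?thesis
    using assms(4) by (auto simp: V_def abs_le_iff minus_le_iff)
qed

lemma \<psi>_nonempty_of_indifferent:
  assumes r0: "r {} = 0" and \<epsilon>: "0 < \<epsilon>" "\<epsilon> < 1" and v: "v \<in> V r" and eq: "equilibrium r v p"
    and le: "payoff r v p $ n \<le> 1" and large: "1 - \<epsilon> < quit_prob p {}"
    and indiff: "\<And>b. b \<in> {0, 1} \<Longrightarrow> payoff r v (deviate p n b) $ n = payoff r v p $ n"
  shows "\<psi> r \<epsilon> v \<noteq> {}"
proof -
  \<comment> \<open>Solves \<open>(1 - t) * quit_prob p {} = 1 - \<epsilon>\<close>; the quotient is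
    at least \<open>1 - \<epsilon>\<close> because \<open>quit_prob p {} \<le> 1\<close>, which
    gives \<open>t \<le> \<epsilon>\<close>.\<close>
  define t where "t = 1 - (1 - \<epsilon>) / quit_prob p {}"
  define q where "q = deviate p n (1 - (1 - p $ n) * (1 - t))"
  have p: "p \<in> profiles"
    using eq by (simp add: equilibrium_def)
  have "quit_prob p {} \<le> 1"
    using member_le_sum[of "{}" UNIV "quit_prob p"] quit_prob_nonneg[OF p]
    by (simp add: sum_quit_prob)
  then have "1 - \<epsilon> \<le> (1 - \<epsilon>) / quit_prob p {}" "(1 - \<epsilon>) / quit_prob p {} < 1"
    using \<epsilon> large mult_left_le[of "quit_prob p {}" "1 - \<epsilon>"] by (auto simp: field_simps)
  then have t: "0 \<le> t" "t \<le> \<epsilon>"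
    by (auto simp: t_def)
  have pn: "0 \<le> p $ n" "p $ n \<le> 1"
    using p by (auto simp: profiles_def)
  then have "(1 - p $ n) * (1 - t) \<le> 1 * 1" "0 \<le> (1 - p $ n) * (1 - t)"
    using t \<epsilon> by (intro mult_mono mult_nonneg_nonneg; simp)+
  then have q: "q \<in> profiles"
    unfolding q_def using p by (intro deviate_in_profiles) auto
  have "payoff r v q $ n = payoff r v p $ n"
    unfolding q_def payoff_deviate_affine by (simp add: indiff algebra_simps)
  then have "payoff r v q \<in> V r"
    using payoff_in_V[OF r0 q v, of n] le by simp
  moreover have "perfect r v (2 * \<epsilon> * r_max r) q"
  proof (rule perfect_mono)
    show "perfect r v (2 * t * r_max r) q"
      unfolding q_def using t \<epsilon> indiff
      by (intro perfect_shift_to_quit r0 p equilibrium_imp_perfect eq) auto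
    show "2 * t * r_max r \<le> 2 * \<epsilon> * r_max r"
      using t r_max_nonneg[of r] by (intro mult_right_mono) auto
  qed
  moreover have "quit_prob q {} = 1 - \<epsilon>"
    unfolding q_def quit_prob_deviate_affine using large \<epsilon> by (simp add: t_def)
  ultimately show ?thesis
    using q by (auto simp: \<psi>_def)
qed

section \<open>Pure profiles and the case distinction\<close>

lemma quit_prob_pure: "quit_prob (\<chi> n. if n \<in> T then 1 else 0) S = (if S = T then 1 else 0)"
proof (cases "S = T")
  case False
  \<comment> \<open>A player on whom \<open>S\<close> and \<open>T\<close> disagree contributes a
    zero factor.\<close>
  then consider n where "n \<in> S" "n \<notin> T" | n where "n \<in> UNIV - S" "n \<in> T"
    by auto
  then show ?thesis
    using False by cases (auto simp: quit_prob_def)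
qed (simp add: quit_prob_def)

lemma payoff_pure:
  assumes "r {} = 0"
  shows "payoff r v (\<chi> n. if n \<in> T then 1 else 0) = (if T = {} then v else r T)"
  using assms by (simp add: payoff_def quit_prob_pure if_distrib[of "\<lambda>c. c *\<^sub>R _"] cong: if_cong)

lemma payoff_continue:
  fixes r :: "'n::finite set \<Rightarrow> real ^ 'n"
  assumes "r {} = 0"
  shows "payoff r v 0 = v"
proof -
  have "(0 :: real ^ 'n) = (\<chi> n. if n \<in> {} then 1 else 0)"
    by (simp add: vec_eq_iff)
  then show ?thesis
    using payoff_pure[where r = r and v = v and T = "{}"] assms by simp
qed

lemma payoff_quit_alone:
  assumes "r {} = 0"
  shows "payoff r v (deviate 0 n 1) = r {n}"
proof -
  have "deviate 0 n 1 = (\<chi> k. if k \<in> {n} then 1 else 0)"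
    by (simp add: vec_eq_iff)
  then show ?thesis
    using payoff_pure[where r = r and v = v and T = "{n}"] assms by simp
qed

theorem proposition3p6:
  fixes r :: "'n::finite set \<Rightarrow> real ^ 'n" and \<epsilon> :: real
  assumes "quitting_game r"
    and "0 < \<epsilon>" and "\<epsilon> < 1"
    and "\<And>n. r {n} $ n = 1"
    and "\<And>v. v \<in> V r \<Longrightarrow> \<exists>p. equilibrium r v p \<and>
           (p = 0 \<or> (p \<noteq> 0 \<and> (\<exists>n. p $ n > 0 \<and> payoff r v p $ n \<le> 1)))"
  shows "\<forall>v\<in>V r. \<psi> r \<epsilon> v \<noteq> {}"
proof
  fix v assume v: "v \<in> V r"
  have r0: "r {} = 0"
    using assms(1) by (simp add: quitting_game_def)
  obtain p where eq: "equilibrium r v p"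
    and p_cases: "p = 0 \<or> (\<exists>n. p $ n > 0 \<and> payoff r v p $ n \<le> 1)"
    using assms(5)[OF v] by blast
  have p: "p \<in> profiles"
    using eq by (simp add: equilibrium_def)
  \<comment> \<open>If \<open>p = 0\<close>, the payoff is \<open>v\<close> itself and
    \<open>v \<in> V r\<close> supplies \<open>n\<close>.\<close>
  obtain n where le: "payoff r v p $ n \<le> 1" and n: "p = 0 \<or> 0 < p $ n"
    using p_cases v by (auto simp: payoff_continue[where r = r, OF r0] V_def)
  show "\<psi> r \<epsilon> v \<noteq> {}"
  proof (cases "quit_prob p {} \<le> 1 - \<epsilon>")
    case True
    have "perfect r v (2 * \<epsilon> * r_max r) p"
      using equilibrium_imp_perfect[OF eq] assms(2) r_max_nonneg[of r]
      by (auto elim: perfect_mono)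
    then show ?thesis
      using True p payoff_in_V[OF r0 p v le] by (auto simp: \<psi>_def)
  next
    case False
    have "payoff r v (deviate p n b) $ n = payoff r v p $ n" if b: "b \<in> {0, 1}" for b
    proof (cases "p = 0")
      case True
      \<comment> \<open>Quitting alone yields \<open>1\<close> and is not profitable, while
        \<open>n\<close> receives at most \<open>1\<close>; thus \<open>n\<close> receives exactly
        \<open>1\<close> and is indifferent.\<close>
      then have "r {n} $ n \<le> payoff r v p $ n"
        using eq payoff_quit_alone[where r = r, OF r0, of v n]
        by (auto simp: equilibrium_def dest!: spec[of _ n] bspec[of _ _ 1])
      then have "payoff r v p $ n = 1"
        using le assms(4) by (metis order_antisym)
      moreover have "deviate p n 0 = p"
        using True by (simp add: vec_eq_iff)
      ultimately show ?thesis
        using b True assms(4) payoff_quit_alone[where r = r, OF r0, of v n] by auto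
    next
      case nonzero: False
      \<comment> \<open>Sure quitting would make \<open>quit_prob p {}\<close> zero, but it exceeds
        \<open>1 - \<epsilon> > 0\<close>. So \<open>n\<close> mixes strictly and is
        indifferent.\<close>
      have "p $ n \<noteq> 1"
      proof
        assume "p $ n = 1"
        then have "deviate p n 1 = p"
          using deviate_same[of p n] by simp
        then have "quit_prob p {} = 0"
          using quit_prob_deviate_quit_empty[of p n] by (simp del: quit_prob_deviate_quit_empty)
        then show False
          using False assms(3) by simp
      qed
      moreover have "p $ n \<le> 1"
        using p by (simp add: profiles_def)
      ultimately show ?thesis
        using equilibrium_pure_payoffs_eq[OF eq _ _ b] n nonzero by simp
    qed
    then show ?thesis
      using False \<psi>_nonempty_of_indifferent[OF r0 assms(2,3) v eq le] by simp
  qed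
qed

end
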